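(* Let $(X,\xi)$ be a convergence space and let $A$ be a non-empty $\xi$-connected subset of $X$. Then $$e(A)=\operatorname{adh}_{\xi}A\cup\operatorname{adh}_{\xi^{*}}A=\operatorname{adh}_{r\xi}A.$$
   Context: Filters are proper set-theoretic filters; $\mathbb{F}X$ is the set of filters on $X$, and $\{x\}^{\uparrow}$ is the principal ultrafilter of $x$. A convergence $\xi$ on $X$ is a relation between points of $X$ and filters on $X$, written $x\in\lim_{\xi}\mathcal{F}$, such that $x\in\lim_{\xi}\{x\}^{\uparrow}$ for every $x\in X$, and $\mathcal{F}\subset\mathcal{G}$ implies $\lim_{\xi}\mathcal{F}\subset\lim_{\xi}\mathcal{G}$ (no further axiom is assumed). $(X,\xi)$ is then a convergence space. A subset $U\subset X$ is $\xi$-open if $\lim_{\xi}\mathcal{F}\cap U\neq\emptyset$ implies $U\in\mathcal{F}$, and $C\subset X$ is $\xi$-closed if $C\in\mathcal{F}$ implies $\lim_{\xi}\mathcal{F}\subset C$. The space $(X,\xi)$ is connected if its only subsets that are both $\xi$-open and $\xi$-closed are $\emptyset$ and $X$. For $A\subset X$, the subspace convergence $\xi_{|A}$ on $A$ is given by $a\in\lim_{\xi_{|A}}\mathcal{F}$ iff $a\in\lim_{\xi}\mathcal{F}^{\uparrow_X}$, where $\mathcal{F}^{\uparrow_X}$ is the filter on $X$ generated by $\mathcal{F}$. $A$ is ($\xi$-)connected if $(A,\xi_{|A})$ is connected. The principal adherence is $\operatorname{adh}_{\xi}A=\bigcup\{\lim_{\xi}\mathcal{G}:\mathcal{G}\in\mathbb{F}X,\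 A\in\mathcal{G}\}$. Also $\operatorname{adh}_{\xi^{*}}A=\{t\in X:\lim_{\xi}\{t\}^{\uparrow}\cap A\neq\emptyset\}$. The reciprocal modification $r\xi$ of $\xi$ is the convergence on $X$ given as follows: if $\mathcal{F}$ is not a principal ultrafilter, then $t\in\lim_{r\xi}\mathcal{F}$ iff $t\in\lim_{\xi}\mathcal{F}$; if $\mathcal{F}=\{x\}^{\uparrow}$, then $t\in\lim_{r\xi}\mathcal{F}$ iff $t\in\lim_{\xi}\{x\}^{\uparrow}$ or $x\in\lim_{\xi}\{t\}^{\uparrow}$. $\operatorname{adh}_{r\xi}$ is the principal adherence of $r\xi$. The enclosure of a non-empty connected set $A$ is $e(A)=\{x\in X: A\cup\{x\}\text{ is }\xi\text{-connected}\}$. *)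

theory Defs
  imports Main
begin

text \<open>
  A proper filter on a carrier \<open>X\<close> is represented by a library filter \<open>F \<noteq> bot\<close> with
  \<open>F \<le> principal X\<close>; for \<open>S \<subseteq> X\<close>, membership of \<open>S\<close> in the filter is
  \<open>eventually (\<lambda>x. x \<in> S) F\<close>. The library order is reverse inclusion of the families of
  members, and \<open>principal {x}\<close> is the principal ultrafilter of \<open>x\<close>.

  For \<open>A \<subseteq> X\<close>, a filter on \<open>A\<close> and the filter it generates on \<open>X\<close> are represented by the
  same library filter (see \<open>generated_filter_members\<close> below).
\<close>

definition filters_on :: "'a set \<Rightarrow> 'a filter set" where
  "filters_on X = {F. F \<noteq> bot \<and> F \<le> principal X}"

definition members_on :: "'a set \<Rightarrow> 'a filter \<Rightarrow> 'a set set" where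
  "members_on X F = {S. S \<subseteq> X \<and> eventually (\<lambda>x. x \<in> S) F}"

text \<open>
  The encoding is an order-reversing bijection onto the proper set-theoretic filters on \<open>X\<close>.
\<close>

lemma members_on_image:
  "members_on X ` filters_on X =
    {\<F>. \<F> \<subseteq> Pow X \<and> X \<in> \<F> \<and> {} \<notin> \<F> \<and> (\<forall>S\<in>\<F>. \<forall>T\<in>\<F>. S \<inter> T \<in> \<F>) \<and>
      (\<forall>S\<in>\<F>. \<forall>T. S \<subseteq> T \<and> T \<subseteq> X \<longrightarrow> T \<in> \<F>)}" (is "?L = ?R")
proof
  show "?L \<subseteq> ?R"
  proof
    fix \<F> assume "\<F> \<in> ?L"
    then obtain F where F: "F \<noteq> bot" "eventually (\<lambda>x. x \<in> X) F" and eq: "\<F> = members_on X F"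
      by (auto simp: filters_on_def le_principal)
    have "T \<in> members_on X F" if "S \<in> members_on X F" "S \<subseteq> T" "T \<subseteq> X" for S T
      using that unfolding members_on_def by (blast intro: eventually_mono)
    moreover have "S \<inter> T \<in> members_on X F" if "S \<in> members_on X F" "T \<in> members_on X F" for S T
      using that eventually_conj[of "\<lambda>x. x \<in> S" F "\<lambda>x. x \<in> T"] unfolding members_on_def by auto
    moreover have "{} \<notin> members_on X F"
      using F(1) by (auto simp: members_on_def trivial_limit_def)
    ultimately show "\<F> \<in> ?R"
      using F(2) unfolding eq by (auto simp: members_on_def)
  qed
  show "?R \<subseteq> ?L"
  proof
    fix \<F> assume "\<F> \<in> ?R"
    then have sub: "\<F> \<subseteq> Pow X" and X: "X \<in> \<F>" and ne: "{} \<notin> \<F>"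
      and int: "\<And>S T. S \<in> \<F> \<Longrightarrow> T \<in> \<F> \<Longrightarrow> S \<inter> T \<in> \<F>"
      and up: "\<And>S T. S \<in> \<F> \<Longrightarrow> S \<subseteq> T \<Longrightarrow> T \<subseteq> X \<Longrightarrow> T \<in> \<F>" by auto
    define F where "F = Abs_filter (\<lambda>P. {x \<in> X. P x} \<in> \<F>)"
    have "is_filter (\<lambda>P. {x \<in> X. P x} \<in> \<F>)"
    proof
      show "{x \<in> X. True} \<in> \<F>" using X by simp
    next
      fix P Q assume "{x \<in> X. P x} \<in> \<F>" "{x \<in> X. Q x} \<in> \<F>"
      from int[OF this] show "{x \<in> X. P x \<and> Q x} \<in> \<F>"
        by (rule back_subst[where P = "\<lambda>S. S \<in> \<F>"]) auto
    next
      fix P Q assume "\<forall>x. P x \<longrightarrow> Q x" "{x \<in> X. P x} \<in> \<F>"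
      then show "{x \<in> X. Q x} \<in> \<F>" by (auto intro: up)
    qed
    then have ev: "eventually P F \<longleftrightarrow> {x \<in> X. P x} \<in> \<F>" for P
      unfolding F_def by (rule eventually_Abs_filter)
    have "F \<in> filters_on X"
      using X ne by (auto simp: filters_on_def le_principal ev trivial_limit_def)
    moreover have "{x \<in> X. x \<in> S} = S" if "S \<subseteq> X" for S using that by auto
    then have "\<F> = members_on X F"
      using sub by (auto simp: members_on_def ev)
    ultimately show "\<F> \<in> ?L" by blast
  qed
qed

lemma members_on_subset_iff:
  assumes "F \<in> filters_on X" "G \<in> filters_on X"
  shows "members_on X F \<subseteq> members_on X G \<longleftrightarrow> G \<le> F"
proof
  assume sub: "members_on X F \<subseteq> members_on X G"
  show "G \<le> F"
  proof (rule filter_leI)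
    fix P assume "eventually P F"
    moreover have "eventually (\<lambda>x. x \<in> X) F"
      using assms(1) by (auto simp: filters_on_def le_principal)
    ultimately have "{x \<in> X. P x} \<in> members_on X F"
      using eventually_conj[of P F "\<lambda>x. x \<in> X"] by (auto simp: members_on_def conj_commute)
    with sub have "eventually (\<lambda>x. x \<in> {x \<in> X. P x}) G"
      unfolding members_on_def by blast
    then show "eventually P G" by (rule eventually_mono) auto
  qed
qed (auto simp: members_on_def filter_leD)

lemma generated_filter_members:
  assumes "A \<subseteq> X" "F \<in> filters_on A"
  shows "members_on X F = {S. S \<subseteq> X \<and> (\<exists>T\<in>members_on A F. T \<subseteq> S)}"
proof -
  have A: "eventually (\<lambda>x. x \<in> A) F"
    using assms(2) by (auto simp: filters_on_def le_principal)
  have "S \<inter> A \<in> members_on A F" if "eventually (\<lambda>x. x \<in> S) F" for S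
    using eventually_conj[OF that A] by (simp add: members_on_def)
  moreover have "eventually (\<lambda>x. x \<in> S) F" if "T \<in> members_on A F" "T \<subseteq> S" for S T
  proof -
    have "eventually (\<lambda>x. x \<in> T) F" using that(1) by (simp add: members_on_def)
    then show ?thesis by (rule eventually_mono) (use that(2) in blast)
  qed
  ultimately have "eventually (\<lambda>x. x \<in> S) F \<longleftrightarrow> (\<exists>T\<in>members_on A F. T \<subseteq> S)" for S
    by (meson inf_le1)
  then show ?thesis
    by (simp add: members_on_def[of X])
qed

text \<open>
  A convergence on \<open>X\<close> is given by \<open>\<xi> F = lim\<^sub>\<xi> F\<close>; only its values on \<open>filters_on X\<close> matter.
\<close>

definition convergence_on :: "'a set \<Rightarrow> ('a filter \<Rightarrow> 'a set) \<Rightarrow> bool" where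
  "convergence_on X \<xi> \<longleftrightarrow>
    (\<forall>F\<in>filters_on X. \<xi> F \<subseteq> X) \<and>
    (\<forall>x\<in>X. x \<in> \<xi> (principal {x})) \<and>
    (\<forall>F\<in>filters_on X. \<forall>G\<in>filters_on X. G \<le> F \<longrightarrow> \<xi> F \<subseteq> \<xi> G)"

definition conv_open :: "'a set \<Rightarrow> ('a filter \<Rightarrow> 'a set) \<Rightarrow> 'a set \<Rightarrow> bool" where
  "conv_open X \<xi> U \<longleftrightarrow> U \<subseteq> X \<and>
    (\<forall>F\<in>filters_on X. \<xi> F \<inter> U \<noteq> {} \<longrightarrow> eventually (\<lambda>x. x \<in> U) F)"

definition conv_closed :: "'a set \<Rightarrow> ('a filter \<Rightarrow> 'a set) \<Rightarrow> 'a set \<Rightarrow> bool" where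
  "conv_closed X \<xi> C \<longleftrightarrow> C \<subseteq> X \<and>
    (\<forall>F\<in>filters_on X. eventually (\<lambda>x. x \<in> C) F \<longrightarrow> \<xi> F \<subseteq> C)"

definition conv_connected_space :: "'a set \<Rightarrow> ('a filter \<Rightarrow> 'a set) \<Rightarrow> bool" where
  "conv_connected_space X \<xi> \<longleftrightarrow>
    (\<forall>U. conv_open X \<xi> U \<and> conv_closed X \<xi> U \<longrightarrow> U = {} \<or> U = X)"

definition subspace_conv :: "('a filter \<Rightarrow> 'a set) \<Rightarrow> 'a set \<Rightarrow> 'a filter \<Rightarrow> 'a set" where
  "subspace_conv \<xi> A F = {a \<in> A. a \<in> \<xi> F}"

definition conv_connected_in :: "'a set \<Rightarrow> ('a filter \<Rightarrow> 'a set) \<Rightarrow> 'a set \<Rightarrow> bool" where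
  "conv_connected_in X \<xi> A \<longleftrightarrow> A \<subseteq> X \<and> conv_connected_space A (subspace_conv \<xi> A)"

definition adh :: "'a set \<Rightarrow> ('a filter \<Rightarrow> 'a set) \<Rightarrow> 'a set \<Rightarrow> 'a set" where
  "adh X \<xi> A = (\<Union>G\<in>{G \<in> filters_on X. eventually (\<lambda>x. x \<in> A) G}. \<xi> G)"

definition adh_star :: "'a set \<Rightarrow> ('a filter \<Rightarrow> 'a set) \<Rightarrow> 'a set \<Rightarrow> 'a set" where
  "adh_star X \<xi> A = {t \<in> X. \<xi> (principal {t}) \<inter> A \<noteq> {}}"

definition reciprocal_mod :: "'a set \<Rightarrow> ('a filter \<Rightarrow> 'a set) \<Rightarrow> 'a filter \<Rightarrow> 'a set" where
  "reciprocal_mod X \<xi> F =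
    (if \<exists>x\<in>X. F = principal {x}
     then {t \<in> X. \<exists>x\<in>X. F = principal {x} \<and> (t \<in> \<xi> (principal {x}) \<or> x \<in> \<xi> (principal {t}))}
     else \<xi> F)"

lemma convergence_on_subspace_conv:
  assumes "convergence_on X \<xi>" "A \<subseteq> X"
  shows "convergence_on A (subspace_conv \<xi> A)"
proof -
  have "principal A \<le> principal X"
    using assms(2) by simp
  then have sub: "F \<in> filters_on X" if "F \<in> filters_on A" for F
    using that order_trans[of F "principal A" "principal X"] by (simp add: filters_on_def)
  have "\<xi> F \<subseteq> \<xi> G" if "F \<in> filters_on A" "G \<in> filters_on A" "G \<le> F" for F G
    using assms(1) sub[OF that(1)] sub[OF that(2)] that(3) by (simp add: convergence_on_def)
  moreover have "x \<in> \<xi> (principal {x})" if "x \<in> A" for x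
    using assms that by (auto simp: convergence_on_def)
  ultimately show ?thesis
    by (auto simp: convergence_on_def subspace_conv_def)
qed

lemma convergence_on_reciprocal_mod:
  assumes "convergence_on X \<xi>"
  shows "convergence_on X (reciprocal_mod X \<xi>)"
proof -
  have lim: "\<xi> F \<subseteq> X" if "F \<in> filters_on X" for F
    using assms that by (auto simp: convergence_on_def)
  have mono: "\<xi> F \<subseteq> \<xi> G" if "F \<in> filters_on X" "G \<in> filters_on X" "G \<le> F" for F G
    using assms that by (auto simp: convergence_on_def)
  have atom: "G = principal {x}" if "G \<in> filters_on X" "G \<le> principal {x}" for G :: "'a filter" and x
  proof (rule antisym[OF that(2)])
    show "principal {x} \<le> G"
    proof (rule filter_leI)
      fix P assume P: "eventually P G"
      show "eventually P (principal {x})"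
      proof (rule ccontr)
        assume "\<not> eventually P (principal {x})"
        then have "\<not> P x" by (simp add: eventually_principal)
        moreover have "eventually (\<lambda>y. y = x) G" using that(2) by (simp add: le_principal)
        ultimately have "eventually (\<lambda>_. False) G" using P
          using eventually_elim2[of "\<lambda>y. y = x" G P "\<lambda>_. False"] by blast
        with that(1) show False by (simp add: filters_on_def trivial_limit_def)
      qed
    qed
  qed
  have "reciprocal_mod X \<xi> F \<subseteq> reciprocal_mod X \<xi> G"
    if FG: "F \<in> filters_on X" "G \<in> filters_on X" "G \<le> F" for F G
  proof (cases "\<exists>x\<in>X. F = principal {x}")
    case True
    then have "G = F" using atom FG by blast
    then show ?thesis by simp
  next
    case False
    then have "reciprocal_mod X \<xi> F = \<xi> F" by (simp add: reciprocal_mod_def)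
    moreover have "\<xi> G \<subseteq> reciprocal_mod X \<xi> G"
      using lim[OF FG(2)] by (auto simp: reciprocal_mod_def)
    ultimately show ?thesis using mono[OF FG] by blast
  qed
  moreover have "reciprocal_mod X \<xi> F \<subseteq> X" if "F \<in> filters_on X" for F
    using lim[OF that] by (auto simp: reciprocal_mod_def)
  moreover have "x \<in> reciprocal_mod X \<xi> (principal {x})" if "x \<in> X" for x
    using assms that by (auto simp: reciprocal_mod_def convergence_on_def)
  ultimately show ?thesis by (simp add: convergence_on_def)
qed

definition enclosure :: "'a set \<Rightarrow> ('a filter \<Rightarrow> 'a set) \<Rightarrow> 'a set \<Rightarrow> 'a set" where
  "enclosure X \<xi> A = {x \<in> X. conv_connected_in X \<xi> (A \<union> {x})}"

end

(* Let x be a point of X outside A and B = A \<union> {x}. A clopen subset of B traces a clopen subset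
   on A, so the only candidates for a nontrivial one are A and {x}; a filter on A converging to x
   excludes both, and so does the convergence of the principal ultrafilter of x to a point of A.
   Conversely, if B is connected then A fails to be open or closed in B, and either failure is
   witnessed by such a filter. *)

theory Submission
  imports Defs
begin

lemma filters_on_mono: "A \<subseteq> B \<Longrightarrow> F \<in> filters_on A \<Longrightarrow> F \<in> filters_on B"
  by (auto simp: filters_on_def intro: order_trans[of F "principal A" "principal B"])

lemma filters_on_eventually: "F \<in> filters_on A \<longleftrightarrow> F \<noteq> bot \<and> eventually (\<lambda>x. x \<in> A) F"
  by (simp add: filters_on_def le_principal)

lemma principal_in_filters_on: "x \<in> X \<Longrightarrow> principal {x} \<in> filters_on X"
  by (simp add: filters_on_def principal_eq_bot_iff)

text \<open>A proper filter on \<open>X\<close> that contains \<open>A\<close> is the same library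
  filter as a proper filter on \<open>A\<close>. Hence the adherence can be computed with filters on
  \<open>A\<close>, which is the form that subspace arguments need; \<open>adhI\<close> is the
  converse.\<close>

lemma adh_subspaceD:
  assumes "A \<subseteq> X" "x \<in> adh X \<xi> A"
  obtains G where "G \<in> filters_on A" "x \<in> \<xi> G"
  using assms by (auto simp: adh_def filters_on_eventually)

lemma adhI:
  assumes "A \<subseteq> X" "G \<in> filters_on A" "x \<in> \<xi> G"
  shows "x \<in> adh X \<xi> A"
  using assms filters_on_mono[OF assms(1,2)] by (auto simp: adh_def filters_on_eventually)

lemma subset_adh:
  assumes "convergence_on X \<xi>" "A \<subseteq> X"
  shows "A \<subseteq> adh X \<xi> A"
proof
  fix x assume "x \<in> A"
  with assms show "x \<in> adh X \<xi> A"
    by (intro adhI[of A X "principal {x}"] principal_in_filters_on) (auto simp: convergence_on_def)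
qed

lemma adh_subset:
  assumes "convergence_on X \<xi>"
  shows "adh X \<xi> A \<subseteq> X"
  using assms by (auto simp: adh_def convergence_on_def)

text \<open>If a property holding eventually failed at \<open>x\<close>, it would confine
  \<open>F\<close> to \<open>A\<close>. So such an \<open>F\<close> is coarser than the principal
  ultrafilter of \<open>x\<close>, and every limit of \<open>F\<close> passes to that ultrafilter by
  monotonicity.\<close>

lemma principal_le_if_not_eventually:
  assumes "eventually (\<lambda>y. y \<in> insert x A) F" "\<not> eventually (\<lambda>y. y \<in> A) F"
  shows "principal {x} \<le> F"
proof (rule filter_leI)
  fix P assume P: "eventually P F"
  have "P x"
  proof (rule ccontr)
    assume "\<not> P x"
    then have "eventually (\<lambda>y. y \<in> A) F"
      using eventually_conj[OF assms(1) P] by (auto elim: eventually_mono)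
    with assms(2) show False by simp
  qed
  then show "eventually P (principal {x})"
    by (simp add: eventually_principal)
qed

text \<open>A filter on \<open>A\<close> is also a filter on \<open>B\<close>, with the same limits
  inside \<open>A\<close>, so the condition on \<open>U\<close> can be applied to it
  directly.\<close>

lemma conv_open_subspace:
  assumes "A \<subseteq> B" "conv_open B (subspace_conv \<xi> B) U"
  shows "conv_open A (subspace_conv \<xi> A) (U \<inter> A)"
  unfolding conv_open_def
proof (intro conjI ballI impI)
  fix F assume F: "F \<in> filters_on A" and "subspace_conv \<xi> A F \<inter> (U \<inter> A) \<noteq> {}"
  then have "subspace_conv \<xi> B F \<inter> U \<noteq> {}"
    using assms(1) by (auto simp: subspace_conv_def)
  then have "eventually (\<lambda>x. x \<in> U) F"
    using assms(2) filters_on_mono[OF assms(1) F] by (simp add: conv_open_def)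
  then show "eventually (\<lambda>x. x \<in> U \<inter> A) F"
    using F by (simp add: filters_on_eventually eventually_conj)
qed simp

lemma conv_closed_subspace:
  assumes "A \<subseteq> B" "conv_closed B (subspace_conv \<xi> B) U"
  shows "conv_closed A (subspace_conv \<xi> A) (U \<inter> A)"
  unfolding conv_closed_def
proof (intro conjI ballI impI)
  fix F assume F: "F \<in> filters_on A" and "eventually (\<lambda>x. x \<in> U \<inter> A) F"
  then have "eventually (\<lambda>x. x \<in> U) F"
    by (auto elim: eventually_mono)
  then have "subspace_conv \<xi> B F \<subseteq> U"
    using assms(2) filters_on_mono[OF assms(1) F] by (simp add: conv_closed_def)
  then show "subspace_conv \<xi> A F \<subseteq> U \<inter> A"
    using assms(1) by (auto simp: subspace_conv_def)
qed simp

text \<open>The trace of a clopen \<open>U\<close> on \<open>A\<close> is clopen in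
  \<open>A\<close>, hence empty or all of \<open>A\<close>. This leaves \<open>{}\<close>,
  \<open>{x}\<close>, \<open>A\<close> and \<open>insert x A\<close> for \<open>U\<close>, and the
  last premise removes the two middle ones.\<close>

lemma conv_connected_in_insertI:
  assumes "conv_connected_in X \<xi> A" "x \<in> X" "x \<notin> A"
    and open_closed: "\<And>U. U = {x} \<or> U = A \<Longrightarrow>
      \<not> (conv_open (insert x A) (subspace_conv \<xi> (insert x A)) U \<and>
         conv_closed (insert x A) (subspace_conv \<xi> (insert x A)) U)"
  shows "conv_connected_in X \<xi> (insert x A)"
  unfolding conv_connected_in_def conv_connected_space_def
proof (intro conjI allI impI)
  show "insert x A \<subseteq> X"
    using assms(1,2) by (simp add: conv_connected_in_def)
next
  fix U
  assume U: "conv_open (insert x A) (subspace_conv \<xi> (insert x A)) U \<and>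
    conv_closed (insert x A) (subspace_conv \<xi> (insert x A)) U"
  then have "conv_open A (subspace_conv \<xi> A) (U \<inter> A)" "conv_closed A (subspace_conv \<xi> A) (U \<inter> A)"
    by (auto intro: conv_open_subspace[OF subset_insertI] conv_closed_subspace[OF subset_insertI])
  then have "U \<inter> A = {} \<or> U \<inter> A = A"
    using assms(1) by (simp add: conv_connected_in_def conv_connected_space_def)
  moreover have "U \<subseteq> insert x A"
    using U by (simp add: conv_open_def)
  moreover have "U \<noteq> {x}" "U \<noteq> A"
    using open_closed U by blast+
  ultimately show "U = {} \<or> U = insert x A"
    by blast
qed

text \<open>A filter on \<open>A\<close> converging to \<open>x\<close> prevents \<open>{x}\<close>
  from being open and \<open>A\<close> from being closed.\<close>

lemma conv_connected_in_insert_adh: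
  assumes "conv_connected_in X \<xi> A" "x \<in> X" "x \<notin> A" "x \<in> adh X \<xi> A"
  shows "conv_connected_in X \<xi> (insert x A)"
proof (rule conv_connected_in_insertI[OF assms(1-3)])
  fix U assume U: "U = {x} \<or> U = A"
  let ?B = "insert x A"
  have "A \<subseteq> X" using assms(1) by (simp add: conv_connected_in_def)
  then obtain G where G: "G \<in> filters_on A" "x \<in> \<xi> G"
    using assms(4) by (rule adh_subspaceD)
  have GB: "G \<in> filters_on ?B" and x: "x \<in> subspace_conv \<xi> ?B G"
    using filters_on_mono[OF subset_insertI G(1)] G(2) by (auto simp: subspace_conv_def)
  have A: "G \<noteq> bot" "eventually (\<lambda>y. y \<in> A) G"
    using G(1) by (simp_all add: filters_on_eventually)
  show "\<not> (conv_open ?B (subspace_conv \<xi> ?B) U \<and> conv_closed ?B (subspace_conv \<xi> ?B) U)"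
    using U
  proof
    assume U: "U = {x}"
    show ?thesis
    proof
      assume "conv_open ?B (subspace_conv \<xi> ?B) U \<and> conv_closed ?B (subspace_conv \<xi> ?B) U"
      then have "eventually (\<lambda>y. y \<in> {x}) G"
        using GB x by (auto simp: conv_open_def U)
      \<comment> \<open>\<open>G\<close> would contain the disjoint sets \<open>A\<close> and
        \<open>{x}\<close>.\<close>
      with A(2) have "eventually (\<lambda>_. False) G"
        by eventually_elim (use assms(3) in auto)
      with A(1) show False by (simp add: trivial_limit_def)
    qed
  next
    assume "U = A"
    then show ?thesis
      using GB A(2) x assms(3) by (auto simp: conv_closed_def)
  qed
qed

text \<open>Dually to the previous case, convergence of the principal ultrafilter of
  \<open>x\<close> to a point of \<open>A\<close> prevents \<open>{x}\<close> from being closed and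
  \<open>A\<close> from being open.\<close>

lemma conv_connected_in_insert_adh_star:
  assumes "conv_connected_in X \<xi> A" "x \<notin> A" "x \<in> adh_star X \<xi> A"
  shows "conv_connected_in X \<xi> (insert x A)"
proof -
  let ?B = "insert x A"
  obtain a where a: "a \<in> A" "a \<in> \<xi> (principal {x})" and "x \<in> X"
    using assms(3) by (auto simp: adh_star_def)
  have lim: "principal {x} \<in> filters_on ?B" "a \<in> subspace_conv \<xi> ?B (principal {x})"
    using a by (auto simp: principal_in_filters_on subspace_conv_def)
  have "a \<notin> {x}" using a(1) assms(2) by blast
  moreover have "eventually (\<lambda>y. y \<in> {x}) (principal {x})"
    by (simp add: eventually_principal)
  ultimately have "\<not> conv_closed ?B (subspace_conv \<xi> ?B) {x}"
    using lim unfolding conv_closed_def by blast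
  moreover have "\<not> conv_open ?B (subspace_conv \<xi> ?B) A"
    using lim a(1) assms(2) by (auto simp: conv_open_def eventually_principal)
  ultimately show ?thesis
    using \<open>x \<in> X\<close> assms(1,2) by (intro conv_connected_in_insertI) auto
qed

text \<open>\<open>A\<close> is a nonempty proper subset of the connected set
  \<open>insert x A\<close>, so it is not clopen there. Failure of openness puts \<open>x\<close> in
  \<open>adh_star\<close>, failure of closedness puts it in \<open>adh\<close>.\<close>

lemma conv_connected_in_insertD:
  assumes "convergence_on X \<xi>" "A \<noteq> {}" "x \<notin> A" "conv_connected_in X \<xi> (insert x A)"
  shows "x \<in> adh X \<xi> A \<union> adh_star X \<xi> A"
proof -
  let ?B = "insert x A"
  have B: "A \<subseteq> X" "x \<in> X" "?B \<subseteq> X" using assms(4) by (auto simp: conv_connected_in_def)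
  have "A \<noteq> ?B" using assms(3) by blast
  then have "\<not> conv_open ?B (subspace_conv \<xi> ?B) A \<or> \<not> conv_closed ?B (subspace_conv \<xi> ?B) A"
    using assms(2,4) unfolding conv_connected_in_def conv_connected_space_def by blast
  then show ?thesis
  proof
    assume "\<not> conv_open ?B (subspace_conv \<xi> ?B) A"
    then obtain F a where F: "F \<in> filters_on ?B" "\<not> eventually (\<lambda>y. y \<in> A) F"
      and a: "a \<in> A" "a \<in> \<xi> F"
      by (auto simp: conv_open_def subspace_conv_def)
    have "principal {x} \<le> F"
      using F by (intro principal_le_if_not_eventually) (auto simp: filters_on_eventually)
    then have "\<xi> F \<subseteq> \<xi> (principal {x})"
      using assms(1) filters_on_mono[OF B(3) F(1)] principal_in_filters_on[OF B(2)]
      by (simp add: convergence_on_def)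
    then show ?thesis using a B(2) by (auto simp: adh_star_def)
  next
    assume "\<not> conv_closed ?B (subspace_conv \<xi> ?B) A"
    then obtain F where "F \<in> filters_on ?B" "eventually (\<lambda>y. y \<in> A) F" "x \<in> \<xi> F"
      by (auto simp: conv_closed_def subspace_conv_def)
    then show ?thesis
      using B(1) by (auto intro!: adhI[of A X F] simp: filters_on_eventually)
  qed
qed

lemma reciprocal_mod_principal:
  assumes "x \<in> X"
  shows "reciprocal_mod X \<xi> (principal {x}) =
    {t \<in> X. t \<in> \<xi> (principal {x}) \<or> x \<in> \<xi> (principal {t})}"
  using assms by (auto simp: reciprocal_mod_def principal_inject)

text \<open>The modification adds limits only to principal ultrafilters, and the one of
  \<open>x\<close> contains \<open>A\<close> exactly when \<open>x\<close> lies in \<open>A\<close>.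
  The added limits are therefore the points whose principal ultrafilter converges into
  \<open>A\<close>, that is, \<open>adh_star\<close>.\<close>

lemma adh_reciprocal_mod:
  assumes "convergence_on X \<xi>" "A \<subseteq> X"
  shows "adh X (reciprocal_mod X \<xi>) A = adh X \<xi> A \<union> adh_star X \<xi> A"
proof (intro equalityI subsetI)
  fix t assume "t \<in> adh X (reciprocal_mod X \<xi>) A"
  with assms(2) obtain G where G: "G \<in> filters_on A" "t \<in> reciprocal_mod X \<xi> G"
    by (rule adh_subspaceD)
  show "t \<in> adh X \<xi> A \<union> adh_star X \<xi> A"
  proof (cases "t \<in> \<xi> G")
    case True
    then show ?thesis using adhI[OF assms(2) G(1)] by blast
  next
    case False
    \<comment> \<open>Off the principal ultrafilters both convergences agree, so a new limit forces
      \<open>G\<close> to be principal.\<close>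
    then obtain x where x: "x \<in> X" "G = principal {x}"
      using G(2) by (auto simp: reciprocal_mod_def split: if_splits)
    then have "x \<in> A"
      using G(1) by (simp add: filters_on_eventually eventually_principal)
    moreover have "t \<in> X" "x \<in> \<xi> (principal {t})"
      using G(2) False x by (auto simp: reciprocal_mod_principal)
    ultimately show ?thesis by (auto simp: adh_star_def)
  qed
next
  fix t assume "t \<in> adh X \<xi> A \<union> adh_star X \<xi> A"
  then show "t \<in> adh X (reciprocal_mod X \<xi>) A"
  proof
    assume t: "t \<in> adh X \<xi> A"
    with assms(2) obtain G where G: "G \<in> filters_on A" "t \<in> \<xi> G"
      by (rule adh_subspaceD)
    moreover have "t \<in> X" using adh_subset[OF assms(1)] t by blast
    ultimately have "t \<in> reciprocal_mod X \<xi> G"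
      by (auto simp: reciprocal_mod_def)
    with assms(2) G(1) show ?thesis by (rule adhI)
  next
    assume "t \<in> adh_star X \<xi> A"
    then obtain a where "t \<in> X" "a \<in> A" "a \<in> \<xi> (principal {t})"
      by (auto simp: adh_star_def)
    \<comment> \<open>Reciprocity swaps the roles of \<open>t\<close> and \<open>a\<close>: the
      ultrafilter of \<open>a\<close> converges to \<open>t\<close> in the modification.\<close>
    then show ?thesis
      using assms(2)
      by (intro adhI[of A X "principal {a}"] principal_in_filters_on)
        (auto simp: reciprocal_mod_principal)
  qed
qed

theorem theorem14:
  fixes X A :: "'a set" and \<xi> :: "'a filter \<Rightarrow> 'a set"
  assumes "convergence_on X \<xi>"
    and "A \<noteq> {}"
    and "conv_connected_in X \<xi> A"
  shows "enclosure X \<xi> A = adh X \<xi> A \<union> adh_star X \<xi> A \<and>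
    adh X \<xi> A \<union> adh_star X \<xi> A = adh X (reciprocal_mod X \<xi>) A"
proof
  have A: "A \<subseteq> X" using assms(3) by (simp add: conv_connected_in_def)
  then show "adh X \<xi> A \<union> adh_star X \<xi> A = adh X (reciprocal_mod X \<xi>) A"
    using adh_reciprocal_mod assms(1) by blast
  have "x \<in> enclosure X \<xi> A \<longleftrightarrow> x \<in> adh X \<xi> A \<union> adh_star X \<xi> A" for x
  proof (cases "x \<in> A")
    case True
    \<comment> \<open>Adding \<open>x\<close> does not change \<open>A\<close>, so both sides hold:
      \<open>A\<close> is connected and lies in its own adherence.\<close>
    then show ?thesis
      using subset_adh[OF assms(1) A] A assms(3) by (auto simp: enclosure_def insert_absorb)
  next
    case False
    have "adh X \<xi> A \<union> adh_star X \<xi> A \<subseteq> X"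
      using adh_subset[OF assms(1)] by (auto simp: adh_star_def)
    then show ?thesis
      using conv_connected_in_insert_adh[OF assms(3) _ False]
        conv_connected_in_insert_adh_star[OF assms(3) False]
        conv_connected_in_insertD[OF assms(1,2) False]
      by (auto simp: enclosure_def)
  qed
  then show "enclosure X \<xi> A = adh X \<xi> A \<union> adh_star X \<xi> A"
    by blast
qed

end
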